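(* Let $k\geq 2$ and $n\geq 2k+1$ be integers, and let $G$ be a simple graph of order $n$. If $\delta(G)\geq k$ and $$\mu(\overline{G})\leq\sqrt{k(n-k-1)},$$ then $G$ is traceable from every vertex, unless one of the following holds: $G=(K_k+K_{n-k-1})\vee K_1$; or $n=2k+1$ and $G\in EW_n$.
   Context: All graphs are finite and simple; equality of graphs is up to isomorphism. $\delta(G)$ is the minimum degree, $\overline{G}$ is the complement of $G$, and $\mu(\cdot)$ is the spectral radius, i.e. the largest eigenvalue of the adjacency matrix. $G_1+G_2$ denotes the disjoint union of graphs $G_1,G_2$, and $G_1\vee G_2$ denotes their join (the disjoint union together with all edges between $V(G_1)$ and $V(G_2)$). $K_m$ is the complete graph on $m$ vertices. A graph is traceable from a vertex $x$ if it has a Hamiltonian path starting at $x$; it is traceable from every vertex if this holds for every vertex $x$. For odd $n$, $EW_n$ is the set of graphs of order $n$ of the form $G_1\vee G_2$, where, for some integer $r$ with $1\leq r\leq\frac{n+1}{2}$, $G_1$ is a regular graph of order $n+1-r$ with degree $\frac{n+1}{2}-r$ and $G_2$ is any graph with $r-1$ vertices (for $r=1$, $G_2$ has no vertices and $G_1\vee G_2=G_1$). *)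

theory Defs
  imports "Graph_Theory.Graph_Theory" "Jordan_Normal_Form.Spectral_Radius"
begin

text \<open>
  Finite simple graphs are the \<^locale>\<open>pair_graph\<close>s of the AFP entry Graph Theory: finite, loopfree,
  symmetric digraphs whose arcs are pairs of vertices.  The graph without vertices is allowed.
  By symmetry, \<^const>\<open>out_degree\<close> is the degree of a vertex.
\<close>

definition min_degree :: "'a pair_pre_digraph \<Rightarrow> nat" where
  "min_degree G = Min (out_degree G ` pverts G)"

definition regular_graph :: "nat \<Rightarrow> 'a pair_pre_digraph \<Rightarrow> bool" where
  "regular_graph d G \<longleftrightarrow> pair_graph G \<and> (\<forall>v \<in> pverts G. out_degree G v = d)"

definition complement_graph :: "'a pair_pre_digraph \<Rightarrow> 'a pair_pre_digraph" where
  "complement_graph G =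
    \<lparr> pverts = pverts G,
      parcs = {(u, v). u \<in> pverts G \<and> v \<in> pverts G \<and> u \<noteq> v \<and> (u, v) \<notin> parcs G} \<rparr>"

definition complete_graph :: "nat \<Rightarrow> nat pair_pre_digraph" where
  "complete_graph m =
    \<lparr> pverts = {..<m}, parcs = {(u, v). u < m \<and> v < m \<and> u \<noteq> v} \<rparr>"

definition disjoint_union ::
  "'a pair_pre_digraph \<Rightarrow> 'b pair_pre_digraph \<Rightarrow> ('a + 'b) pair_pre_digraph" where
  "disjoint_union G H =
    \<lparr> pverts = pverts G <+> pverts H,
      parcs = map_prod Inl Inl ` parcs G \<union> map_prod Inr Inr ` parcs H \<rparr>"

definition join_graph ::
  "'a pair_pre_digraph \<Rightarrow> 'b pair_pre_digraph \<Rightarrow> ('a + 'b) pair_pre_digraph" where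
  "join_graph G H =
    \<lparr> pverts = pverts (disjoint_union G H),
      parcs = parcs (disjoint_union G H)
        \<union> (Inl ` pverts G) \<times> (Inr ` pverts H) \<union> (Inr ` pverts H) \<times> (Inl ` pverts G) \<rparr>"

definition adjacency_mat :: "'a list \<Rightarrow> 'a pair_pre_digraph \<Rightarrow> real mat" where
  "adjacency_mat xs G =
    mat (length xs) (length xs) (\<lambda>(i, j). if (xs ! i, xs ! j) \<in> parcs G then 1 else 0)"

text \<open>
  The order in which the vertices are listed is irrelevant, see
  \<open>graph_spectral_radius_eq\<close> below.
\<close>

definition graph_spectral_radius :: "'a pair_pre_digraph \<Rightarrow> real" where
  "graph_spectral_radius G =
    Max (spectrum (adjacency_mat (SOME xs. distinct xs \<and> set xs = pverts G) G))"

definition traceable_from :: "'a pair_pre_digraph \<Rightarrow> 'a \<Rightarrow> bool" where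
  "traceable_from G x \<longleftrightarrow> (\<exists>p. vpath p G \<and> set p = pverts G \<and> hd p = x)"

text \<open>
  As graphs are taken up to isomorphism, the two parts can be taken with natural numbers as
  vertices.
\<close>

definition EW :: "nat \<Rightarrow> 'a pair_pre_digraph set" where
  "EW n = {G. odd n \<and> pair_graph G \<and>
    (\<exists>r (G1 :: nat pair_pre_digraph) (G2 :: nat pair_pre_digraph).
      1 \<le> r \<and> r \<le> (n + 1) div 2 \<and>
      regular_graph ((n + 1) div 2 - r) G1 \<and> card (pverts G1) = n + 1 - r \<and>
      pair_graph G2 \<and> card (pverts G2) = r - 1 \<and>
      digraph_iso G (join_graph G1 G2))}"

lemma pair_graph_iff:
  "pair_graph G \<longleftrightarrow> finite (pverts G) \<and> parcs G \<subseteq> pverts G \<times> pverts G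
    \<and> sym (parcs G) \<and> irrefl (parcs G)"
proof
  assume "pair_graph G"
  then interpret pair_graph G .
  show "finite (pverts G) \<and> parcs G \<subseteq> pverts G \<times> pverts G \<and> sym (parcs G) \<and> irrefl (parcs G)"
    using pair_finite_verts in_arcsD1 in_arcsD2 no_loops' arcs_symmetric
    unfolding sym_def irrefl_def by fast
next
  assume *: "finite (pverts G) \<and> parcs G \<subseteq> pverts G \<times> pverts G \<and> sym (parcs G) \<and> irrefl (parcs G)"
  then have "finite (parcs G)"
    by (meson finite_SigmaI finite_subset)
  with * show "pair_graph G"
    by unfold_locales (auto simp: symmetric_def irrefl_def)
qed

lemma pair_graph_complement: "pair_graph G \<Longrightarrow> pair_graph (complement_graph G)"
  by (auto simp: pair_graph_iff complement_graph_def sym_def irrefl_def)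

lemma pair_graph_complete: "pair_graph (complete_graph m)"
  by (auto simp: pair_graph_iff complete_graph_def sym_def irrefl_def)

lemma complete_digraph_complete_graph: "K\<^bsub>m\<^esub> (with_proj (complete_graph m))"
  by (auto simp: complete_digraph_pair_def complete_graph_def)

lemma pair_graph_disjoint_union:
  "pair_graph G \<Longrightarrow> pair_graph H \<Longrightarrow> pair_graph (disjoint_union G H)"
  by (fastforce simp: pair_graph_iff disjoint_union_def sym_def irrefl_def)

lemma pair_graph_join:
  assumes "pair_graph G" "pair_graph H"
  shows "pair_graph (join_graph G H)"
  using pair_graph_disjoint_union[OF assms]
  by (simp add: pair_graph_iff join_graph_def sym_def irrefl_def) (auto simp: disjoint_union_def)

lemma eigenvalue_adjacency_mat_iff:
  assumes xs: "distinct xs" "set xs = pverts G"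
  shows "eigenvalue (adjacency_mat xs G) l \<longleftrightarrow>
    (\<exists>f. (\<exists>v \<in> pverts G. f v \<noteq> 0) \<and>
      (\<forall>v \<in> pverts G. (\<Sum>u \<in> pverts G. (if (v, u) \<in> parcs G then f u else 0)) = l * f v))"
    (is "_ \<longleftrightarrow> (\<exists>f. ?nz f \<and> ?ev f)")
proof -
  let ?n = "length xs"
  have bij: "bij_betw ((!) xs) {0..<?n} (pverts G)"
    using bij_betw_nth[OF xs(1), of "{0..<?n}" "pverts G"] xs(2) by (simp add: lessThan_atLeast0)
  have mult: "(adjacency_mat xs G *\<^sub>v vec ?n (\<lambda>i. f (xs ! i))) $ i
      = (\<Sum>u \<in> pverts G. (if (xs ! i, u) \<in> parcs G then f u else 0))" if "i < ?n" for f i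
    using that unfolding sum.reindex_bij_betw[OF bij, symmetric]
    by (auto simp: adjacency_mat_def scalar_prod_def intro!: sum.cong)
  have iff: "eigenvector (adjacency_mat xs G) (vec ?n (\<lambda>i. f (xs ! i))) l \<longleftrightarrow> ?nz f \<and> ?ev f" for f
  proof -
    have "vec ?n (\<lambda>i. f (xs ! i)) \<noteq> 0\<^sub>v ?n \<longleftrightarrow> (\<exists>i < ?n. f (xs ! i) \<noteq> 0)"
      by (auto simp: vec_eq_iff)
    also have "\<dots> \<longleftrightarrow> ?nz f"
      unfolding xs(2)[symmetric] by (metis in_set_conv_nth)
    finally have "vec ?n (\<lambda>i. f (xs ! i)) \<noteq> 0\<^sub>v ?n \<longleftrightarrow> ?nz f" .
    moreover have "adjacency_mat xs G *\<^sub>v vec ?n (\<lambda>i. f (xs ! i)) = l \<cdot>\<^sub>v vec ?n (\<lambda>i. f (xs ! i))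
      \<longleftrightarrow> (\<forall>i < ?n. (\<Sum>u \<in> pverts G. (if (xs ! i, u) \<in> parcs G then f u else 0)) = l * f (xs ! i))"
      by (subst vec_eq_iff) (simp add: mult del: index_mult_mat_vec, simp add: adjacency_mat_def)
    moreover have "\<dots> \<longleftrightarrow> ?ev f"
      unfolding xs(2)[symmetric] by (simp add: all_set_conv_all_nth)
    moreover have "dim_row (adjacency_mat xs G) = ?n"
      by (simp add: adjacency_mat_def)
    ultimately show ?thesis by (simp add: eigenvector_def)
  qed
  show ?thesis
  proof
    assume "eigenvalue (adjacency_mat xs G) l"
    then obtain v where v: "eigenvector (adjacency_mat xs G) v l"
      by (auto simp: eigenvalue_def)
    define f where "f = (\<lambda>x. v $ inv_into {0..<?n} ((!) xs) x)"
    have "v = vec ?n (\<lambda>i. f (xs ! i))"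
      using v bij by (auto simp: eigenvector_def adjacency_mat_def f_def bij_betw_def inv_into_f_f)
    then have "eigenvector (adjacency_mat xs G) (vec ?n (\<lambda>i. f (xs ! i))) l"
      using v by simp
    then show "\<exists>f. ?nz f \<and> ?ev f" using iff[of f] by blast
  next
    assume "\<exists>f. ?nz f \<and> ?ev f"
    then obtain f where "?nz f \<and> ?ev f" by blast
    then show "eigenvalue (adjacency_mat xs G) l"
      using iff[of f] unfolding eigenvalue_def by blast
  qed
qed

lemma graph_spectral_radius_eq:
  assumes "distinct xs" "set xs = pverts G"
  shows "graph_spectral_radius G = Max (spectrum (adjacency_mat xs G))"
proof -
  let ?ys = "SOME xs. distinct xs \<and> set xs = pverts G"
  have "distinct ?ys \<and> set ?ys = pverts G"
    using assms by (intro someI[of "\<lambda>xs. distinct xs \<and> set xs = pverts G" xs]) simp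
  then have "spectrum (adjacency_mat ?ys G) = spectrum (adjacency_mat xs G)"
    using assms by (auto simp: spectrum_def eigenvalue_adjacency_mat_iff)
  then show ?thesis by (simp add: graph_spectral_radius_def)
qed

end

theory Submission
  imports Defs "HOL-Analysis.Function_Topology"
begin

text \<open>
  Suppose that \<open>G\<close> has no Hamiltonian path starting at \<open>x\<close>.  Being Hamiltonian from \<open>x\<close> is an
  \<open>n\<close>-stable property in the sense of Bondy and Chvatal: adding an edge between two vertices
  whose degrees sum to at least \<open>n\<close> does not create it (\<open>hamiltonian_from_stable\<close>).  Hence an
  edge-maximal supergraph \<open>E\<close> of \<open>G\<close> without such a path has degree sum at most \<open>n - 1\<close> at every
  non-adjacent pair.  In the complement \<open>B\<close> of \<open>E\<close> every edge therefore has degree sum at least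
  \<open>n - 1\<close>; as all degrees of \<open>E\<close> are at least \<open>k\<close>, both degrees lie between \<open>k\<close> and
  \<open>n - 1 - k\<close>, and their product is at least \<open>s\<^sup>2 = k * (n - k - 1)\<close>.

  Let \<open>A\<close> be the complement of \<open>G\<close>, so \<open>B \<subseteq> A\<close>.  The bound on the spectral radius says that the
  quadratic form of \<open>A\<close> is at most \<open>s\<close> times the squared norm.  For the vector
  \<open>f v = sqrt (deg v)\<close>, with degrees taken in \<open>B\<close>, the form of \<open>B\<close> alone already reaches \<open>s\<close>
  times the squared norm, so all estimates are equalities
  (\<open>edge_degree_product_rigidity\<close>): the two ends of a \<open>B\<close>-edge have degrees \<open>k\<close> and \<open>n - 1 - k\<close>,
  and, \<open>f\<close> being an eigenvector, every edge of \<open>A\<close> outside \<open>B\<close> joins two isolated vertices of \<open>B\<close>.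

  Let \<open>W\<close> be the set of non-isolated vertices of \<open>B\<close>.  If \<open>n = 2 * k + 1\<close>, then \<open>B\<close> is \<open>k\<close>-regular
  on \<open>W\<close>, and \<open>G\<close> is the join of its regular restriction to \<open>W\<close> with an arbitrary graph.
  Otherwise the two degrees differ, \<open>B\<close> is bipartite between them, and counting vertices leaves
  only a complete bipartite graph with parts of sizes \<open>k\<close> and \<open>n - k - 1\<close> and one further vertex.
\<close>

section \<open>The quadratic form of a symmetric kernel\<close>

lemma linear_term_zero_if_quadratic_nonneg:
  fixes p q :: real
  assumes "\<And>t. 0 \<le> t * p + t\<^sup>2 * q"
  shows "p = 0"
proof (rule ccontr)
  assume p: "p \<noteq> 0"
  \<comment> \<open>Moving against the slope by \<open>\<bar>p\<bar> / c\<close> with \<open>c > \<bar>q\<bar>\<close> keeps the quadratic term below the linear one.\<close>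
  define c where "c = \<bar>q\<bar> + 1"
  have c: "c > 0" "q < c" by (auto simp: c_def)
  have "(- p / c) * p + (- p / c)\<^sup>2 * q = p\<^sup>2 / c\<^sup>2 * (q - c)"
    using c by (simp add: field_simps power2_eq_square)
  also have "\<dots> < 0"
    using p c by (intro mult_pos_neg) auto
  finally show False using assms[of "- p / c"] by simp
qed

text \<open>
  The first-order condition at a maximum of the Rayleigh quotient: perturbing \<open>f\<close> by \<open>t\<close> at the single
  vertex \<open>w\<close> turns the slack \<open>m * |f|\<^sup>2 - Q f\<close> into a quadratic polynomial in \<open>t\<close> that is nonnegative
  and vanishes at \<open>0\<close>; its linear coefficient is twice the \<open>w\<close>-th entry of \<open>m * f - a f\<close>.
\<close>

lemma quadratic_form_maximizer_eigenvector:
  fixes a :: "'a \<Rightarrow> 'a \<Rightarrow> real"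
  assumes fin: "finite V" and sym: "\<And>u v. a u v = a v u"
    and le: "\<And>g. (\<Sum>u\<in>V. \<Sum>v\<in>V. a u v * g u * g v) \<le> m * (\<Sum>v\<in>V. (g v)\<^sup>2)"
    and eq: "(\<Sum>u\<in>V. \<Sum>v\<in>V. a u v * f u * f v) = m * (\<Sum>v\<in>V. (f v)\<^sup>2)"
    and w: "w \<in> V"
  shows "(\<Sum>u\<in>V. a w u * f u) = m * f w"
proof -
  define A where "A u = (\<Sum>v\<in>V. a u v * f v)" for u
  define e where "e v = (if v = w then 1 else 0 :: real)" for v
  have sum_e: "(\<Sum>v\<in>V. h v * e v) = h w" for h :: "'a \<Rightarrow> real"
    using fin w by (simp add: e_def if_distrib[of "\<lambda>x. _ * x"] cong: if_cong)
  have "0 \<le> t * (2 * (m * f w - A w)) + t\<^sup>2 * (m - a w w)" for t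
  proof -
    define g where "g v = f v + t * e v" for v
    have "(\<Sum>v\<in>V. a u v * g u * g v) = g u * (A u + t * a u w)" for u
    proof -
      have "(\<Sum>v\<in>V. a u v * g u * g v) = (\<Sum>v\<in>V. g u * (a u v * f v) + g u * t * a u v * e v)"
        by (intro sum.cong) (auto simp: g_def algebra_simps)
      also have "\<dots> = g u * A u + (\<Sum>v\<in>V. (g u * t * a u v) * e v)"
        by (simp add: sum.distrib A_def sum_distrib_left)
      finally show ?thesis unfolding sum_e by (simp add: algebra_simps)
    qed
    then have "(\<Sum>u\<in>V. \<Sum>v\<in>V. a u v * g u * g v) = (\<Sum>u\<in>V. g u * (A u + t * a u w))"
      by simp
    also have "\<dots> = (\<Sum>u\<in>V. f u * A u + t * (a u w * f u) + (t * (A u + t * a u w)) * e u)"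
      by (intro sum.cong) (auto simp: g_def algebra_simps)
    also have "\<dots> = (\<Sum>u\<in>V. f u * A u) + t * (\<Sum>u\<in>V. a u w * f u) + t * (A w + t * a w w)"
      by (simp add: sum.distrib sum_e sum_distrib_left)
    also have "(\<Sum>u\<in>V. a u w * f u) = A w"
      unfolding A_def by (intro sum.cong) (auto simp: sym)
    also have "(\<Sum>u\<in>V. f u * A u) = m * (\<Sum>v\<in>V. (f v)\<^sup>2)"
      unfolding eq[symmetric] A_def by (simp add: sum_distrib_left algebra_simps)
    finally have 1: "(\<Sum>u\<in>V. \<Sum>v\<in>V. a u v * g u * g v)
      = m * (\<Sum>v\<in>V. (f v)\<^sup>2) + t * A w + t * (A w + t * a w w)" .
    have "(\<Sum>v\<in>V. (g v)\<^sup>2) = (\<Sum>v\<in>V. (f v)\<^sup>2 + (2 * t * f v + t\<^sup>2 * e v) * e v)"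
      by (intro sum.cong) (auto simp: g_def power2_eq_square algebra_simps)
    also have "\<dots> = (\<Sum>v\<in>V. (f v)\<^sup>2) + (2 * t * f w + t\<^sup>2 * e w)"
      by (simp add: sum.distrib sum_e)
    finally have 2: "(\<Sum>v\<in>V. (g v)\<^sup>2) = (\<Sum>v\<in>V. (f v)\<^sup>2) + (2 * t * f w + t\<^sup>2)"
      by (simp add: e_def)
    from le[of g] show ?thesis
      unfolding 1 2 by (simp add: algebra_simps power2_eq_square)
  qed
  then have "2 * (m * f w - A w) = 0"
    by (rule linear_term_zero_if_quadratic_nonneg)
  then show ?thesis by (simp add: A_def)
qed

text \<open>
  The Rayleigh quotient attains its maximum since the unit sphere is compact.  Functions on all
  vertices of the type carry the product topology, so coordinates outside \<open>V\<close> are pinned to \<open>0\<close> to get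
  a compact box.
\<close>

lemma quadratic_form_largest_eigenvalue:
  fixes a :: "'a \<Rightarrow> 'a \<Rightarrow> real"
  assumes fin: "finite V" and ne: "V \<noteq> {}" and sym: "\<And>u v. a u v = a v u"
  obtains m f where "\<exists>v\<in>V. f v \<noteq> 0" "\<And>w. w \<in> V \<Longrightarrow> (\<Sum>u\<in>V. a w u * f u) = m * f w"
    "\<And>g. (\<Sum>u\<in>V. \<Sum>v\<in>V. a u v * g u * g v) \<le> m * (\<Sum>v\<in>V. (g v)\<^sup>2)"
proof -
  define Q where "Q g = (\<Sum>u\<in>V. \<Sum>v\<in>V. a u v * g u * g v)" for g :: "'a \<Rightarrow> real"
  define N where "N g = (\<Sum>v\<in>V. (g v)\<^sup>2)" for g :: "'a \<Rightarrow> real"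
  define box where "box = Pi\<^sub>E UNIV (\<lambda>v. if v \<in> V then {-1..1} else {0::real})"
  define K where "K = box \<inter> {g. N g = 1}"
  have Nnonneg: "0 \<le> N g" for g unfolding N_def by (simp add: sum_nonneg)
  have coord: "continuous_on UNIV (\<lambda>g::'a \<Rightarrow> real. g v)" for v
    by (rule continuous_on_product_coordinates)
  have contN: "continuous_on UNIV N"
    unfolding N_def by (intro continuous_intros coord)
  have contQ: "continuous_on UNIV Q"
    unfolding Q_def by (intro continuous_intros coord)
  have "compactin (product_topology (\<lambda>i. euclidean) UNIV) box"
    unfolding box_def by (subst compactin_PiE) auto
  then have "compact box"
    by (simp add: euclidean_product_topology)
  moreover have "closed {g. N g = 1}"
    by (intro closed_Collect_eq contN continuous_on_const)
  ultimately have comp: "compact K"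
    unfolding K_def by (rule compact_Int_closed)
  have scale: "\<exists>h\<in>K. Q g = N g * Q h" if g: "N g \<noteq> 0" for g
  proof
    define c where "c = sqrt (N g)"
    define h where "h v = (if v \<in> V then g v / c else 0)" for v
    have c: "c > 0" "c\<^sup>2 = N g" using g Nnonneg[of g] by (auto simp: c_def)
    have sq: "(g v)\<^sup>2 \<le> N g" if "v \<in> V" for v
      unfolding N_def using that fin by (intro member_le_sum) auto
    have gc: "\<bar>g v\<bar> \<le> c" if "v \<in> V" for v
      unfolding c_def using sq[OF that] by (simp add: real_le_rsqrt)
    have "- 1 \<le> h v" "h v \<le> 1" if "v \<in> V" for v
      using gc[OF that] c that by (auto simp: h_def abs_le_iff field_simps)
    then have "h \<in> box"
      by (auto simp: box_def PiE_iff) (simp add: h_def)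
    moreover have "N h = N g / c\<^sup>2"
      unfolding N_def by (simp add: h_def power_divide sum_divide_distrib)
    ultimately show "h \<in> K" using c g by (simp add: K_def)
    have "Q h = Q g / c\<^sup>2"
      unfolding Q_def by (simp add: h_def power2_eq_square sum_divide_distrib algebra_simps)
    then show "Q g = N g * Q h" using c g by simp
  qed
  obtain v0 where v0: "v0 \<in> V" using ne by blast
  define e where "e v = (if v = v0 then 1 else 0 :: real)" for v
  have "N e = 1"
    using fin v0 by (simp add: N_def e_def if_distrib[of "\<lambda>x. x ^ 2"] cong: if_cong)
  then have "K \<noteq> {}" using scale[of e] by auto
  then obtain f where f: "f \<in> K" "\<And>h. h \<in> K \<Longrightarrow> Q h \<le> Q f"
    using continuous_attains_sup[OF comp _ continuous_on_subset[OF contQ]] by blast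
  have le: "Q g \<le> Q f * N g" for g
  proof (cases "N g = 0")
    case True
    then have "\<forall>v\<in>V. g v = 0" using fin by (auto simp: N_def sum_nonneg_eq_0_iff)
    then show ?thesis using True by (simp add: Q_def)
  next
    case False
    from scale[OF this] obtain h where h: "h \<in> K" "Q g = N g * Q h" by blast
    from f(2)[OF h(1)] Nnonneg[of g] show ?thesis
      unfolding h(2) by (metis mult.commute mult_left_mono)
  qed
  have Nf: "N f = 1" using f by (simp add: K_def)
  show ?thesis
  proof
    show "\<exists>v\<in>V. f v \<noteq> 0" using Nf by (intro ccontr[of "\<exists>v\<in>V. f v \<noteq> 0"]) (simp add: N_def)
    show "(\<Sum>u\<in>V. a w u * f u) = Q f * f w" if "w \<in> V" for w
      by (rule quadratic_form_maximizer_eigenvector[OF fin sym _ _ that])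
        (use le Nf in \<open>simp_all add: Q_def N_def\<close>)
    show "(\<Sum>u\<in>V. \<Sum>v\<in>V. a u v * g u * g v) \<le> Q f * (\<Sum>v\<in>V. (g v)\<^sup>2)" for g
      using le[of g] by (simp add: Q_def N_def)
  qed
qed

lemma sum_indicator_arcs:
  fixes h :: "'a \<Rightarrow> 'a \<Rightarrow> real"
  assumes "finite V" "A \<subseteq> V \<times> V"
  shows "(\<Sum>u\<in>V. \<Sum>v\<in>V. of_bool ((u, v) \<in> A) * h u v) = (\<Sum>(u, v)\<in>A. h u v)"
proof -
  have "(\<Sum>u\<in>V. \<Sum>v\<in>V. of_bool ((u, v) \<in> A) * h u v)
      = (\<Sum>(u, v)\<in>V \<times> V. of_bool ((u, v) \<in> A) * h u v)"
    by (simp add: sum.cartesian_product)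
  also have "\<dots> = (\<Sum>(u, v)\<in>A. h u v)"
    using assms by (intro sum.mono_neutral_cong_right) auto
  finally show ?thesis .
qed

text \<open>
  The maximum of the Rayleigh quotient is an eigenvalue, hence at most the largest one.
\<close>

lemma arc_sum_le_spectral_radius:
  fixes g :: "'a \<Rightarrow> real"
  assumes G: "pair_graph G" and ne: "pverts G \<noteq> {}"
  shows "(\<Sum>(u, v)\<in>parcs G. g u * g v) \<le> graph_spectral_radius G * (\<Sum>v\<in>pverts G. (g v)\<^sup>2)"
proof -
  have fin: "finite (pverts G)" and sub: "parcs G \<subseteq> pverts G \<times> pverts G" and sy: "sym (parcs G)"
    using G by (auto simp: pair_graph_iff)
  define a where "a u v = (of_bool ((u, v) \<in> parcs G) :: real)" for u v
  have "a u v = a v u" for u v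
    using symD[OF sy] by (auto simp: a_def)
  then obtain m f where f: "\<exists>v\<in>pverts G. f v \<noteq> 0"
    "\<And>w. w \<in> pverts G \<Longrightarrow> (\<Sum>u\<in>pverts G. a w u * f u) = m * f w"
    "\<And>g. (\<Sum>u\<in>pverts G. \<Sum>v\<in>pverts G. a u v * g u * g v) \<le> m * (\<Sum>v\<in>pverts G. (g v)\<^sup>2)"
    by (rule quadratic_form_largest_eigenvalue[of "pverts G" a, OF fin ne]) blast
  obtain xs where xs: "distinct xs" "set xs = pverts G"
    using finite_distinct_list[OF fin] by blast
  have "(\<Sum>u\<in>pverts G. a w u * f u) = (\<Sum>u\<in>pverts G. if (w, u) \<in> parcs G then f u else 0)" for w
    by (intro sum.cong) (auto simp: a_def)
  then have "eigenvalue (adjacency_mat xs G) m"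
    unfolding eigenvalue_adjacency_mat_iff[OF xs] using f(1,2) by (intro exI[of _ f]) auto
  moreover have "adjacency_mat xs G \<in> carrier_mat (length xs) (length xs)"
    by (simp add: adjacency_mat_def)
  ultimately have "m \<le> graph_spectral_radius G"
    unfolding graph_spectral_radius_eq[OF xs]
    by (intro Max_ge card_finite_spectrum(1)) (auto simp: spectrum_def)
  then have "m * (\<Sum>v\<in>pverts G. (g v)\<^sup>2) \<le> graph_spectral_radius G * (\<Sum>v\<in>pverts G. (g v)\<^sup>2)"
    by (intro mult_right_mono sum_nonneg) auto
  moreover have "(\<Sum>(u, v)\<in>parcs G. g u * g v)
      = (\<Sum>u\<in>pverts G. \<Sum>v\<in>pverts G. a u v * g u * g v)"
    unfolding sum_indicator_arcs[OF fin sub, symmetric] a_def by (simp add: mult.assoc)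
  ultimately show ?thesis using f(3)[of g] by linarith
qed

section \<open>Edges with large degree product\<close>

text \<open>
  The spectral radius of a graph is at least the minimum over its edges of the geometric mean of the
  two end degrees, as the square roots of the degrees show when they are used as a test vector.  This is
  the case of equality, for a graph \<open>B\<close> inside a graph \<open>A\<close> that obeys the bound:
  \<open>s * card B \<le> Q\<^sub>B f \<le> Q\<^sub>A f \<le> s * |f|\<^sup>2 = s * card B\<close>.  So each edge of \<open>B\<close> is tight, and an edge of
  \<open>A - B\<close> has an end where \<open>f\<close> vanishes.  Moreover \<open>f\<close> is an eigenvector of \<open>A\<close>, so by nonnegativity a
  zero of \<open>f\<close> has only zeros as neighbours, and the other end is isolated in \<open>B\<close> as well.
\<close>

lemma edge_degree_product_rigidity:
  fixes A B :: "'a rel"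
  assumes fin: "finite V" and A: "A \<subseteq> V \<times> V" "sym A" and B: "B \<subseteq> A"
    and s: "0 \<le> s"
    and form: "\<And>g :: 'a \<Rightarrow> real. (\<Sum>(u, v)\<in>A. g u * g v) \<le> s * (\<Sum>v\<in>V. (g v)\<^sup>2)"
    and prod: "\<And>u v. (u, v) \<in> B \<Longrightarrow> s\<^sup>2 \<le> real (card (B `` {u}) * card (B `` {v}))"
  shows "\<And>u v. (u, v) \<in> B \<Longrightarrow> real (card (B `` {u}) * card (B `` {v})) = s\<^sup>2"
    and "\<And>u v. (u, v) \<in> A - B \<Longrightarrow> B `` {u} = {} \<and> B `` {v} = {}"
proof -
  define f where "f v = sqrt (real (card (B `` {v})))" for v
  have finA: "finite A" using A fin by (meson finite_SigmaI finite_subset)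
  have finB: "finite B" using B finA by (rule finite_subset)
  have finN: "finite (B `` {v})" for v using finB by (rule finite_Image)
  have fnn: "0 \<le> f v" for v by (simp add: f_def)
  have f0: "f v = 0 \<longleftrightarrow> B `` {v} = {}" for v using finN[of v] by (simp add: f_def)
  have ge: "s \<le> f u * f v" if "(u, v) \<in> B" for u v
    using prod[OF that] by (simp add: f_def real_sqrt_mult[symmetric] real_le_rsqrt)
  have norm: "(\<Sum>v\<in>V. (f v)\<^sup>2) = real (card B)"
  proof -
    have "B = Sigma V (\<lambda>v. B `` {v})" using A B by auto
    then have "card B = (\<Sum>v\<in>V. card (B `` {v}))"
      using card_SigmaI[OF fin, of "\<lambda>v. B `` {v}"] finN by metis
    then show ?thesis by (simp add: f_def)
  qed
  have split: "(\<Sum>(u, v)\<in>A. f u * f v) = (\<Sum>(u, v)\<in>A - B. f u * f v) + (\<Sum>(u, v)\<in>B. f u * f v)"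
    using sum.subset_diff[OF B finA] .
  have "(\<Sum>(u, v)\<in>B. f u * f v - s) = (\<Sum>(u, v)\<in>B. f u * f v) - s * card B"
    by (simp add: case_prod_unfold sum_subtractf mult.commute)
  moreover have "0 \<le> (\<Sum>(u, v)\<in>B. f u * f v - s)"
    using ge by (intro sum_nonneg) auto
  moreover have "0 \<le> (\<Sum>(u, v)\<in>A - B. f u * f v)"
    using fnn by (intro sum_nonneg) auto
  ultimately have eqs: "(\<Sum>(u, v)\<in>B. f u * f v - s) = 0" "(\<Sum>(u, v)\<in>A - B. f u * f v) = 0"
    "(\<Sum>(u, v)\<in>A. f u * f v) = s * card B"
    using form[of f] split unfolding norm by linarith+
  show "real (card (B `` {u}) * card (B `` {v})) = s\<^sup>2" if uv: "(u, v) \<in> B" for u v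
  proof -
    have "f u * f v - s = 0"
      using eqs(1) uv ge finB by (subst (asm) sum_nonneg_eq_0_iff) auto
    then have "s = sqrt (real (card (B `` {u}) * card (B `` {v})))"
      by (simp add: f_def real_sqrt_mult)
    then show ?thesis by simp
  qed
  define a where "a u v = (of_bool ((u, v) \<in> A) :: real)" for u v
  have asym: "a u v = a v u" for u v
    using symD[OF A(2)] by (auto simp: a_def)
  have Q: "(\<Sum>u\<in>V. \<Sum>v\<in>V. a u v * g u * g v) = (\<Sum>(u, v)\<in>A. g u * g v)" for g
    unfolding sum_indicator_arcs[OF fin A(1), symmetric] a_def by (simp add: mult.assoc)
  have eigen: "(\<Sum>u\<in>V. a w u * f u) = s * f w" if "w \<in> V" for w
    by (rule quadratic_form_maximizer_eigenvector[OF fin asym _ _ that])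
      (unfold Q norm, rule form, rule eqs)
  have isolated: "f v = 0" if "f u = 0" "(u, v) \<in> A" for u v
  proof -
    have uv: "u \<in> V" "v \<in> V" using that A by auto
    then have "(\<Sum>w\<in>V. a u w * f w) = 0" using eigen that by simp
    then have "a u v * f v = 0"
      using fin uv fnn by (subst (asm) sum_nonneg_eq_0_iff) (auto simp: a_def)
    then show ?thesis using that by (simp add: a_def)
  qed
  show "B `` {u} = {} \<and> B `` {v} = {}" if uv: "(u, v) \<in> A - B" for u v
  proof -
    have "f u * f v = 0"
    proof -
      have "\<forall>e\<in>A - B. (\<lambda>(u, v). f u * f v) e = 0"
        using eqs(2) fnn finA by (subst (asm) sum_nonneg_eq_0_iff) auto
      from this[rule_format, OF uv] show ?thesis by simp
    qed
    moreover have "(v, u) \<in> A" using uv A by (auto simp: sym_def)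
    ultimately show ?thesis using isolated uv unfolding f0[symmetric] by auto
  qed
qed

text \<open>
  With \<open>a = k + i\<close>, \<open>b = k + j\<close> and \<open>i + j = l + t\<close> the product exceeds \<open>k * (k + l)\<close> by
  \<open>k * t + i * j\<close>.
\<close>

lemma degree_product_bound:
  fixes a b k l :: nat
  assumes "k \<le> a" "a \<le> k + l" "k \<le> b" "b \<le> k + l" "2 * k + l \<le> a + b"
  shows "k * (k + l) \<le> a * b"
    and "a * b = k * (k + l) \<Longrightarrow> 1 \<le> k \<Longrightarrow> a = k \<and> b = k + l \<or> a = k + l \<and> b = k"
proof -
  obtain i j where ij: "a = k + i" "b = k + j" using assms by (metis le_Suc_ex)
  have l: "l \<le> i + j" using assms ij by auto
  obtain t where t: "i + j = l + t" using l le_Suc_ex by blast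
  have ab: "a * b = k * (k + l) + k * t + i * j"
  proof -
    have "a * b = k * k + k * (i + j) + i * j" by (simp add: ij algebra_simps)
    then show ?thesis unfolding t by (simp add: algebra_simps)
  qed
  show "k * (k + l) \<le> a * b" unfolding ab by simp
  assume "a * b = k * (k + l)" "1 \<le> k"
  then have "t = 0" "i = 0 \<or> j = 0" unfolding ab by auto
  then show "a = k \<and> b = k + l \<or> a = k + l \<and> b = k" using t ij by auto
qed

section \<open>Hamiltonian paths with a prescribed start\<close>

text \<open>
  Rotation of a path whose \<open>i\<close>-th step may be missing.  Reversing the segment between the positions
  \<open>i\<close> and \<open>j\<close> (excluding the first of the two) replaces the steps after \<open>i\<close> and after \<open>j\<close> by the
  chords \<open>(p ! i, p ! j)\<close> and \<open>(p ! Suc i, p ! Suc j)\<close>; the latter is absent if \<open>j\<close> is the last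
  position.  The start of the path stays in place because the reversed segment never contains position
  \<open>0\<close>.
\<close>

lemma reverse_segment:
  assumes sy: "sym E" and p: "distinct p" "\<And>t. Suc t < length p \<Longrightarrow> t \<noteq> i \<Longrightarrow> (p ! t, p ! Suc t) \<in> E"
    and i: "Suc i < length p"
    and j: "j < length p" "j \<noteq> i" "(p ! i, p ! j) \<in> E"
      "Suc j < length p \<Longrightarrow> (p ! Suc i, p ! Suc j) \<in> E"
  shows "\<exists>q. distinct q \<and> set q = set p \<and> hd q = hd p \<and> successively (\<lambda>x y. (x, y) \<in> E) q"
proof -
  define l where "l = min i j"
  define m where "m = max i j"
  have lm: "l < m" "m < length p" using i j by (auto simp: l_def m_def)
  have "i = l \<and> j = m \<or> i = m \<and> j = l" by (auto simp: l_def m_def)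
  then have e: "(p ! l, p ! m) \<in> E" "Suc m < length p \<Longrightarrow> (p ! Suc l, p ! Suc m) \<in> E"
    and il: "i = l \<or> i = m"
    using i j lm sy by (auto simp: sym_def)
  define a where "a = take (Suc l) p"
  define b where "b = drop (Suc l) (take (Suc m) p)"
  define c where "c = drop (Suc m) p"
  have ab: "a @ b = take (Suc m) p"
    using append_take_drop_id[of "Suc l" "take (Suc m) p"] lm
    by (simp add: a_def b_def min_def)
  then have p_eq: "p = a @ b @ c"
    unfolding c_def by (metis append.assoc append_take_drop_id)
  have ne: "a \<noteq> []" "b \<noteq> []" using lm by (auto simp: a_def b_def)
  have succ: "successively (\<lambda>x y. (x, y) \<in> E) a" "successively (\<lambda>x y. (x, y) \<in> E) b"
    "successively (\<lambda>x y. (x, y) \<in> E) c"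
    unfolding successively_conv_nth a_def b_def c_def using p(2) lm il by auto
  have ac_ends: "last a = p ! l" "last b = p ! m" "c \<noteq> [] \<Longrightarrow> hd c = p ! Suc m"
    using lm by (simp_all add: a_def take_Suc_conv_app_nth)
      (simp_all add: b_def c_def last_drop hd_drop_conv_nth take_Suc_conv_app_nth[of m])
  have "hd b = p ! Suc l"
    using lm by (simp add: b_def hd_drop_conv_nth)
  note ends = ac_ends this
  have "successively (\<lambda>x y. (x, y) \<in> E) (rev b)"
    using succ(2) sy by (auto elim!: successively_mono simp: sym_def)
  moreover have "c \<noteq> [] \<Longrightarrow> (hd b, hd c) \<in> E"
    using ends e(2) by (simp add: c_def)
  ultimately have "successively (\<lambda>x y. (x, y) \<in> E) (a @ rev b @ c)"
    using succ ne e ends by (cases "c = []") (simp_all add: successively_append_iff hd_append last_rev hd_rev)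
  moreover have "distinct (a @ rev b @ c)" "set (a @ rev b @ c) = set p" "hd (a @ rev b @ c) = hd p"
    using p(1) ne unfolding p_eq by auto
  ultimately show ?thesis by blast
qed

text \<open>
  The crossing argument of Ore.  Let \<open>S\<close> collect the positions of neighbours of \<open>p ! i\<close> and \<open>T\<close> the
  predecessors of positions of neighbours of \<open>p ! Suc i\<close>.  If no segment can be reversed, then \<open>S\<close> and
  \<open>T\<close> are disjoint subsets of \<open>{..<n - 1} - {i}\<close>.  A neighbour at the start of the path has no predecessor,
  so the degree sum is at most \<open>(n - 2) + 1\<close>.
\<close>

lemma hamiltonian_path_avoiding_edge:
  assumes sy: "sym E" and ir: "irrefl E" and p: "distinct p"
    "\<And>t. Suc t < length p \<Longrightarrow> t \<noteq> i \<Longrightarrow> (p ! t, p ! Suc t) \<in> E"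
    and i: "Suc i < length p" "(p ! i, p ! Suc i) \<notin> E"
    and sub: "E \<subseteq> set p \<times> set p"
    and deg: "length p \<le> card (E `` {p ! i}) + card (E `` {p ! Suc i})"
  shows "\<exists>q. distinct q \<and> set q = set p \<and> hd q = hd p \<and> successively (\<lambda>x y. (x, y) \<in> E) q"
proof (rule ccontr)
  assume no: "\<not> ?thesis"
  define n where "n = length p"
  define S where "S = {j. j < n \<and> (p ! i, p ! j) \<in> E}"
  define T where "T = {j. Suc j < n \<and> (p ! Suc i, p ! Suc j) \<in> E}"
  have iS: "i \<notin> S" "i \<notin> T" using ir by (auto simp: S_def T_def irrefl_def)
  have noj: "\<not> (j < n \<and> (p ! i, p ! j) \<in> E \<and> (Suc j < n \<longrightarrow> (p ! Suc i, p ! Suc j) \<in> E))" for j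
  proof
    assume j: "j < n \<and> (p ! i, p ! j) \<in> E \<and> (Suc j < n \<longrightarrow> (p ! Suc i, p ! Suc j) \<in> E)"
    then have "j \<noteq> i" using ir by (auto simp: irrefl_def)
    with j no reverse_segment[OF sy p i(1), of j] show False by (auto simp: n_def)
  qed
  have "S \<inter> T = {}" using noj by (auto simp: S_def T_def)
  have "S \<subseteq> {..<n}" "T \<subseteq> {..<n}" by (auto simp: S_def T_def)
  then have fin: "finite S" "finite T" using finite_subset by blast+
  have "S \<union> T \<subseteq> {..<n - 1} - {i}"
  proof
    fix j assume j: "j \<in> S \<union> T"
    have "j \<noteq> i" using iS j by auto
    moreover have "Suc j < n"
      using j noj[of j] by (auto simp: S_def T_def)
    ultimately show "j \<in> {..<n - 1} - {i}" by auto
  qed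
  then have "card (S \<union> T) \<le> card ({..<n - 1} - {i})" by (intro card_mono) auto
  also have "\<dots> = n - 2" using i by (subst card_Diff_subset) (auto simp: n_def)
  finally have 1: "card S + card T \<le> n - 2"
    using card_Un_disjoint[OF fin \<open>S \<inter> T = {}\<close>] by simp
  have "E `` {p ! i} \<subseteq> (!) p ` S"
    using sub by (fastforce simp: S_def n_def in_set_conv_nth image_iff)
  then have 2: "card (E `` {p ! i}) \<le> card S"
    using fin by (meson surj_card_le)
  have "E `` {p ! Suc i} \<subseteq> insert (p ! 0) ((\<lambda>j. p ! Suc j) ` T)"
  proof
    fix w assume w: "w \<in> E `` {p ! Suc i}"
    then obtain j where j: "j < n" "w = p ! j"
      using sub by (metis Image_singleton_iff SigmaD2 in_set_conv_nth n_def subsetD)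
    then show "w \<in> insert (p ! 0) ((\<lambda>j. p ! Suc j) ` T)"
      using w by (cases j) (auto simp: T_def)
  qed
  then have "card (E `` {p ! Suc i}) \<le> card (insert (p ! 0) ((\<lambda>j. p ! Suc j) ` T))"
    using fin by (intro card_mono) auto
  also have "\<dots> \<le> Suc (card T)"
    using card_insert_le_m1 card_image_le[OF fin(2)] fin
    by (metis card_insert_if finite_imageI Suc_le_mono le_SucI)
  finally have "n \<le> n - 2 + 1" using deg 1 2 by (simp add: n_def)
  then show False using i by (simp add: n_def)
qed

text \<open>
  A version of \<^const>\<open>traceable_from\<close> that depends only on the vertex set and the arc relation, so
  that arcs can be added freely.
\<close>

definition hamiltonian_from :: "'a set \<Rightarrow> 'a rel \<Rightarrow> 'a \<Rightarrow> bool" where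
  "hamiltonian_from V E x \<longleftrightarrow>
    (\<exists>p. distinct p \<and> set p = V \<and> hd p = x \<and> successively (\<lambda>u v. (u, v) \<in> E) p)"

lemma set_vwalk_arcs_subset_iff: "set (vwalk_arcs p) \<subseteq> E \<longleftrightarrow> successively (\<lambda>u v. (u, v) \<in> E) p"
  by (induction p rule: vwalk_arcs.induct) auto

lemma traceable_from_iff:
  assumes "x \<in> pverts G"
  shows "traceable_from G x \<longleftrightarrow> hamiltonian_from (pverts G) (parcs G) x"
proof -
  have "arcs_ends (with_proj G) = parcs G"
    by (auto simp: arcs_ends_def arc_to_ends_def)
  then show ?thesis
    using assms unfolding traceable_from_def hamiltonian_from_def vpath_def vwalk_def
    by (auto simp: set_vwalk_arcs_subset_iff)
qed

text \<open>
  A path visits each vertex once, so it uses the added edge in at most one step, and that step can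
  be rerouted.
\<close>

lemma hamiltonian_from_stable:
  assumes sy: "sym E" and ir: "irrefl E" and sub: "E \<subseteq> V \<times> V"
    and uv: "(u, v) \<notin> E" and deg: "card V \<le> card (E `` {u}) + card (E `` {v})"
    and ham: "hamiltonian_from V (insert (u, v) (insert (v, u) E)) x"
  shows "hamiltonian_from V E x"
proof -
  from ham obtain p where p: "distinct p" "set p = V" "hd p = x"
    "\<And>t. Suc t < length p \<Longrightarrow> (p ! t, p ! Suc t) \<in> insert (u, v) (insert (v, u) E)"
    unfolding hamiltonian_from_def successively_conv_nth by blast
  show ?thesis
  proof (cases "successively (\<lambda>u v. (u, v) \<in> E) p")
    case True
    then show ?thesis using p unfolding hamiltonian_from_def by blast
  next
    case False
    then obtain i where i: "Suc i < length p" "(p ! i, p ! Suc i) \<notin> E"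
      unfolding successively_conv_nth by blast
    then have ends: "p ! i = u \<and> p ! Suc i = v \<or> p ! i = v \<and> p ! Suc i = u"
      using p(4)[OF i(1)] by auto
    have "(p ! t, p ! Suc t) \<in> E" if t: "Suc t < length p" "t \<noteq> i" for t
    proof (rule ccontr)
      assume "(p ! t, p ! Suc t) \<notin> E"
      then have "p ! t = p ! i \<or> p ! t = p ! Suc i \<and> p ! Suc t = p ! i"
        using p(4)[OF t(1)] ends by auto
      then show False using p(1) t i by (auto simp: nth_eq_iff_index_eq)
    qed
    moreover have "length p = card V" using distinct_card[OF p(1)] p(2) by simp
    moreover have "E \<subseteq> set p \<times> set p" using sub p(2) by simp
    moreover have "card (E `` {p ! i}) + card (E `` {p ! Suc i}) = card (E `` {u}) + card (E `` {v})"
      using ends by (elim disjE) simp_all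
    ultimately have "\<exists>q. distinct q \<and> set q = set p \<and> hd q = hd p \<and> successively (\<lambda>x y. (x, y) \<in> E) q"
      using deg by (intro hamiltonian_path_avoiding_edge[OF sy ir p(1) _ i]) simp_all
    then show ?thesis unfolding hamiltonian_from_def p(2,3) .
  qed
qed

lemma hamiltonian_from_complete:
  assumes "finite V" "x \<in> V" "\<And>u v. u \<in> V \<Longrightarrow> v \<in> V \<Longrightarrow> u \<noteq> v \<Longrightarrow> (u, v) \<in> E"
  shows "hamiltonian_from V E x"
proof -
  obtain q where q: "set q = V - {x}" "distinct q"
    using finite_distinct_list[of "V - {x}"] assms by auto
  have "successively (\<lambda>u v. (u, v) \<in> E) p" if "distinct p" "set p \<subseteq> V" for p
    using that unfolding successively_conv_nth
    by (auto intro!: assms(3) simp: nth_eq_iff_index_eq subset_iff)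
  from this[of "x # q"] show ?thesis
    unfolding hamiltonian_from_def using q assms(2) by (intro exI[of _ "x # q"]) auto
qed

lemma maximal_not_hamiltonian_from:
  assumes fin: "finite V" and E0: "E0 \<subseteq> V \<times> V" "sym E0" "irrefl E0"
    and non: "\<not> hamiltonian_from V E0 x"
  obtains E where "E0 \<subseteq> E" "E \<subseteq> V \<times> V" "sym E" "irrefl E" "\<not> hamiltonian_from V E x"
    "\<And>u v. u \<in> V \<Longrightarrow> v \<in> V \<Longrightarrow> u \<noteq> v \<Longrightarrow> (u, v) \<notin> E \<Longrightarrow> card (E `` {u}) + card (E `` {v}) < card V"
proof -
  define F where "F = {E. E \<subseteq> V \<times> V \<and> sym E \<and> irrefl E \<and> \<not> hamiltonian_from V E x}"
  have "finite F"
    unfolding F_def using fin by (auto intro: finite_subset[of _ "Pow (V \<times> V)"])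
  moreover have "E0 \<in> F" using assms by (auto simp: F_def)
  ultimately obtain E where E: "E \<in> F" "E0 \<subseteq> E" and max: "\<And>E'. E' \<in> F \<Longrightarrow> E \<subseteq> E' \<Longrightarrow> E = E'"
    using finite_has_maximal2[of F E0] by auto
  show ?thesis
  proof
    show "E0 \<subseteq> E" "E \<subseteq> V \<times> V" "sym E" "irrefl E" "\<not> hamiltonian_from V E x"
      using E by (auto simp: F_def)
    fix u v assume uv: "u \<in> V" "v \<in> V" "u \<noteq> v" "(u, v) \<notin> E"
    define E' where "E' = insert (u, v) (insert (v, u) E)"
    have "E' \<notin> F" using max[of E'] uv by (auto simp: E'_def)
    moreover have "E' \<subseteq> V \<times> V" "sym E'" "irrefl E'"
      using E uv by (auto simp: F_def E'_def sym_def irrefl_def)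
    ultimately have "hamiltonian_from V E' x" by (simp add: F_def)
    then show "card (E `` {u}) + card (E `` {v}) < card V"
      using hamiltonian_from_stable[of E V u v x] E uv
      by (auto simp: F_def E'_def not_less[symmetric])
  qed
qed

section \<open>Isomorphisms onto joins\<close>

lemma digraph_iso_if_bij_betw:
  assumes G: "pair_graph G" and H: "pair_graph H"
    and bij: "bij_betw h (pverts G) (pverts H)"
    and arcs: "\<And>u v. u \<in> pverts G \<Longrightarrow> v \<in> pverts G \<Longrightarrow> (h u, h v) \<in> parcs H \<longleftrightarrow> (u, v) \<in> parcs G"
  shows "digraph_iso (with_proj G) (with_proj H)"
proof -
  define f where "f = \<lparr>iso_verts = h, iso_arcs = map_prod h h, iso_head = snd, iso_tail = fst\<rparr>"
  have sub: "parcs G \<subseteq> pverts G \<times> pverts G" "parcs H \<subseteq> pverts H \<times> pverts H"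
    using G H by (auto simp: pair_graph_iff)
  have inj: "inj_on h (pverts G)" and img: "h ` pverts G = pverts H"
    using bij by (auto simp: bij_betw_def)
  interpret pair_graph G by (rule G)
  have "inj_on (map_prod h h) (parcs G)"
    using map_prod_inj_on[OF inj inj] sub inj_on_subset by blast
  then have "pre_digraph.digraph_isomorphism (with_proj G) f"
    unfolding pre_digraph.digraph_isomorphism_def using inj wf_digraph_axioms
    by (auto simp: f_def)
  moreover have "map_prod h h ` parcs G = parcs H"
  proof
    show "map_prod h h ` parcs G \<subseteq> parcs H" using arcs sub by auto
    show "parcs H \<subseteq> map_prod h h ` parcs G"
    proof
      fix e assume e: "e \<in> parcs H"
      then obtain u v where "e = (h u, h v)" "u \<in> pverts G" "v \<in> pverts G"
        using sub img by (cases e) blast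
      then show "e \<in> map_prod h h ` parcs G" using e arcs by force
    qed
  qed
  then have "with_proj H = app_iso f (with_proj G)"
    using img by (simp add: f_def app_iso_def with_proj_def)
  ultimately show ?thesis unfolding digraph_iso_def by blast
qed

lemma out_degree_pair: "out_degree (with_proj G) v = card (parcs G `` {v})"
proof -
  have "out_arcs (with_proj G) v = Pair v ` (parcs G `` {v})"
    by (auto simp: out_arcs_def)
  then show ?thesis by (simp add: out_degree_def card_image inj_on_def)
qed

text \<open>
  The graphs that witness membership in \<^const>\<open>EW\<close> have natural numbers as vertices, so induced
  subgraphs have to be renamed.
\<close>

lemma nat_copy_of_induced_subgraph:
  assumes G: "pair_graph G" and P: "P \<subseteq> pverts G"
  obtains h :: "'a \<Rightarrow> nat" and H where "pair_graph H" "bij_betw h P (pverts H)"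
    "\<And>u v. u \<in> P \<Longrightarrow> v \<in> P \<Longrightarrow> (h u, h v) \<in> parcs H \<longleftrightarrow> (u, v) \<in> parcs G"
    "\<And>v. v \<in> P \<Longrightarrow> out_degree (with_proj H) (h v) = card (parcs G `` {v} \<inter> P)"
proof -
  have g: "finite (pverts G)" "sym (parcs G)" "irrefl (parcs G)"
    using G by (auto simp: pair_graph_iff)
  have finP: "finite P" using P g(1) finite_subset by blast
  then obtain h where h: "bij_betw h P {0..<card P}"
    using ex_bij_betw_finite_nat by blast
  then have inj: "inj_on h P" by (rule bij_betw_imp_inj_on)
  define H where "H = \<lparr>pverts = h ` P, parcs = {(h u, h v) | u v. u \<in> P \<and> v \<in> P \<and> (u, v) \<in> parcs G}\<rparr>"
  have arcs: "(h u, h v) \<in> parcs H \<longleftrightarrow> (u, v) \<in> parcs G" if "u \<in> P" "v \<in> P" for u v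
    using that by (auto simp: H_def inj_on_eq_iff[OF inj])
  show ?thesis
  proof
    show "pair_graph H"
      unfolding pair_graph_iff using finP g
      by (auto simp: H_def sym_def irrefl_def inj_on_eq_iff[OF inj])
    show "bij_betw h P (pverts H)" using inj by (simp add: H_def bij_betw_def)
    show "(h u, h v) \<in> parcs H \<longleftrightarrow> (u, v) \<in> parcs G" if "u \<in> P" "v \<in> P" for u v
      by (rule arcs[OF that])
    show "out_degree (with_proj H) (h v) = card (parcs G `` {v} \<inter> P)" if v: "v \<in> P" for v
    proof -
      have "parcs H `` {h v} = h ` (parcs G `` {v} \<inter> P)"
          using v by (auto simp: H_def inj_on_eq_iff[OF inj])
      then show ?thesis
        using inj by (simp add: out_degree_pair card_image inj_on_subset)
    qed
  qed
qed

lemma in_parcs_disjoint_union: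
  "(Inl a, Inl b) \<in> parcs (disjoint_union G H) \<longleftrightarrow> (a, b) \<in> parcs G"
  "(Inr c, Inr d) \<in> parcs (disjoint_union G H) \<longleftrightarrow> (c, d) \<in> parcs H"
  "(Inl a, Inr d) \<notin> parcs (disjoint_union G H)"
  "(Inr c, Inl b) \<notin> parcs (disjoint_union G H)"
  by (force simp: disjoint_union_def)+

lemma in_parcs_join_graph:
  "(Inl a, Inl b) \<in> parcs (join_graph G H) \<longleftrightarrow> (a, b) \<in> parcs G"
  "(Inr c, Inr d) \<in> parcs (join_graph G H) \<longleftrightarrow> (c, d) \<in> parcs H"
  "(Inl a, Inr d) \<in> parcs (join_graph G H) \<longleftrightarrow> a \<in> pverts G \<and> d \<in> pverts H"
  "(Inr c, Inl b) \<in> parcs (join_graph G H) \<longleftrightarrow> c \<in> pverts H \<and> b \<in> pverts G"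
  by (auto simp: join_graph_def in_parcs_disjoint_union)

lemma join_decomposition:
  assumes G: "pair_graph G" and P: "P \<subseteq> pverts G"
    and cross: "P \<times> (pverts G - P) \<subseteq> parcs G"
    and reg: "\<And>v. v \<in> P \<Longrightarrow> card (parcs G `` {v} \<inter> P) = d"
  obtains G1 G2 :: "nat pair_pre_digraph" where
    "regular_graph d G1" "card (pverts G1) = card P"
    "pair_graph G2" "card (pverts G2) = card (pverts G - P)"
    "digraph_iso (with_proj G) (with_proj (join_graph G1 G2))"
proof -
  obtain h1 G1 where 1: "pair_graph G1" "bij_betw h1 P (pverts G1)"
    "\<And>u v. u \<in> P \<Longrightarrow> v \<in> P \<Longrightarrow> ((h1 u :: nat), h1 v) \<in> parcs G1 \<longleftrightarrow> (u, v) \<in> parcs G"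
    "\<And>v. v \<in> P \<Longrightarrow> out_degree (with_proj G1) (h1 v) = card (parcs G `` {v} \<inter> P)"
    using nat_copy_of_induced_subgraph[OF G P] by metis
  obtain h2 G2 where 2: "pair_graph G2" "bij_betw h2 (pverts G - P) (pverts G2)"
    "\<And>u v. u \<in> pverts G - P \<Longrightarrow> v \<in> pverts G - P \<Longrightarrow>
      ((h2 u :: nat), h2 v) \<in> parcs G2 \<longleftrightarrow> (u, v) \<in> parcs G"
    using nat_copy_of_induced_subgraph[OF G, of "pverts G - P"] by (metis Diff_subset)
  define h where "h v = (if v \<in> P then Inl (h1 v) else Inr (h2 v))" for v
  have in1: "h1 v \<in> pverts G1" if "v \<in> P" for v using 1(2) that by (rule bij_betwE[rule_format])
  have in2: "h2 v \<in> pverts G2" if "v \<in> pverts G - P" for v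
    using 2(2) that by (rule bij_betwE[rule_format])
  have "bij_betw h (pverts G) (pverts (join_graph G1 G2))"
  proof -
    have "bij_betw h P (Inl ` pverts G1)"
      using 1(2) unfolding bij_betw_def h_def by (auto simp: inj_on_def image_image[symmetric])
    moreover have "bij_betw h (pverts G - P) (Inr ` pverts G2)"
      using 2(2) unfolding bij_betw_def h_def inj_on_def by (auto simp: image_iff)
    ultimately have "bij_betw h (P \<union> (pverts G - P)) (Inl ` pverts G1 \<union> Inr ` pverts G2)"
      by (rule bij_betw_combine) auto
    moreover have "P \<union> (pverts G - P) = pverts G" using P by auto
    ultimately show ?thesis by (simp add: join_graph_def disjoint_union_def Plus_def)
  qed
  moreover have "(h u, h v) \<in> parcs (join_graph G1 G2) \<longleftrightarrow> (u, v) \<in> parcs G"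
    if uv: "u \<in> pverts G" "v \<in> pverts G" for u v
  proof -
    have cross': "(pverts G - P) \<times> P \<subseteq> parcs G"
      using cross G by (auto simp: pair_graph_iff sym_def)
    show ?thesis
      using uv 1(3)[of u v] 2(3)[of u v] in1[of u] in1[of v] in2[of u] in2[of v] cross cross'
      by (cases "u \<in> P"; cases "v \<in> P")
        (auto simp: h_def in_parcs_join_graph)
  qed
  ultimately have "digraph_iso (with_proj G) (with_proj (join_graph G1 G2))"
    using G pair_graph_join[OF 1(1) 2(1)] by (intro digraph_iso_if_bij_betw) auto
  moreover have "regular_graph d G1"
    unfolding regular_graph_def bij_betw_imp_surj_on[OF 1(2), symmetric] using 1(1,4) reg by simp
  moreover have "card (pverts G1) = card P" "card (pverts G2) = card (pverts G - P)"
    using 1(2) 2(2) bij_betw_same_card by metis+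
  ultimately show ?thesis using 2(1) that by blast
qed

lemma iso_two_cliques_join_vertex:
  assumes G: "pair_graph G" and V: "pverts G = insert z (Y \<union> X)"
    and disj: "Y \<inter> X = {}" "z \<notin> Y" "z \<notin> X"
    and arcs: "\<And>u v. u \<in> pverts G \<Longrightarrow> v \<in> pverts G \<Longrightarrow>
      (u, v) \<in> parcs G \<longleftrightarrow> u \<noteq> v \<and> \<not> (u \<in> Y \<and> v \<in> X) \<and> \<not> (u \<in> X \<and> v \<in> Y)"
  shows "digraph_iso (with_proj G) (with_proj (join_graph
    (disjoint_union (complete_graph (card Y)) (complete_graph (card X))) (complete_graph 1)))"
    (is "digraph_iso _ (with_proj ?H)")
proof -
  have fin: "finite Y" "finite X"
    using G V by (auto simp: pair_graph_iff)
  obtain h1 h2 where h: "bij_betw h1 Y {0..<card Y}" "bij_betw h2 X {0..<card X}"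
    using ex_bij_betw_finite_nat fin by meson
  define h where "h v = (if v \<in> Y then Inl (Inl (h1 v)) else if v \<in> X then Inl (Inr (h2 v)) else Inr (0::nat))" for v
  have inj: "inj_on h1 Y" "inj_on h2 X" and img: "h1 ` Y = {0..<card Y}" "h2 ` X = {0..<card X}"
    using h by (auto simp: bij_betw_def)
  have lt: "v \<in> Y \<Longrightarrow> h1 v < card Y" "v \<in> X \<Longrightarrow> h2 v < card X" for v
    using img by auto
  have H_verts: "pverts ?H = insert (Inr 0) (Inl ` (Inl ` {0..<card Y} \<union> Inr ` {0..<card X}))"
    by (simp add: join_graph_def disjoint_union_def complete_graph_def Plus_def
        lessThan_atLeast0 image_Un insert_commute)
  have "bij_betw h (pverts G) (pverts ?H)"
  proof -
    have "inj_on h (pverts G)"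
      using inj disj unfolding V inj_on_def h_def by auto
    moreover have "h ` Y = Inl ` Inl ` {0..<card Y}"
      unfolding img[symmetric] image_image h_def by auto
    moreover have "h ` X = Inl ` Inr ` {0..<card X}"
      unfolding img[symmetric] image_image using disj by (intro image_cong) (auto simp: h_def)
    moreover have "h z = Inr 0" using disj by (simp add: h_def)
    ultimately show ?thesis
      unfolding bij_betw_def H_verts V by (simp add: image_Un)
  qed
  moreover have "(h u, h v) \<in> parcs ?H \<longleftrightarrow> (u, v) \<in> parcs G"
    if uv: "u \<in> pverts G" "v \<in> pverts G" for u v
  proof -
    have same: "v1 \<in> Y \<Longrightarrow> v2 \<in> Y \<Longrightarrow> h1 v1 = h1 v2 \<longleftrightarrow> v1 = v2"
      "v1 \<in> X \<Longrightarrow> v2 \<in> X \<Longrightarrow> h2 v1 = h2 v2 \<longleftrightarrow> v1 = v2" for v1 v2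
      using inj by (auto simp: inj_on_eq_iff)
    have trichotomy: "w \<in> Y \<and> w \<notin> X \<or> w \<in> X \<and> w \<notin> Y \<or> w = z \<and> z \<notin> X \<and> z \<notin> Y"
      if "w \<in> pverts G" for w
      using that disj unfolding V by auto
    have verts: "Inl a \<in> pverts (disjoint_union (complete_graph k) (complete_graph l)) \<longleftrightarrow> a < k"
      "Inr b \<in> pverts (disjoint_union (complete_graph k) (complete_graph l)) \<longleftrightarrow> b < l" for a b k l
      by (auto simp: disjoint_union_def complete_graph_def)
    have edges: "(i, j) \<in> parcs (complete_graph k) \<longleftrightarrow> i < k \<and> j < k \<and> i \<noteq> j" for i j k
      by (simp add: complete_graph_def)
    have vert: "0 \<in> pverts (complete_graph 1)"
      by (simp add: complete_graph_def)
    show ?thesis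
      unfolding arcs[OF uv] using trichotomy[OF uv(1)] trichotomy[OF uv(2)]
      by (elim disjE conjE)
        (simp_all only: h_def if_True if_False simp_thms in_parcs_join_graph in_parcs_disjoint_union
          verts edges vert lt same, auto)
  qed
  ultimately show ?thesis
    using G by (intro digraph_iso_if_bij_betw pair_graph_join pair_graph_disjoint_union
        pair_graph_complete) auto
qed

section \<open>Graphs whose complement has small spectral radius\<close>

theorem theorem2p13:
  fixes k n :: nat and G :: "'a pair_pre_digraph"
  assumes "k \<ge> 2" and "n \<ge> 2 * k + 1"
    and "pair_graph G" and "card (pverts G) = n"
    and "min_degree G \<ge> k"
    and "graph_spectral_radius (complement_graph G) \<le> sqrt (real k * (real n - real k - 1))"
  shows "(\<forall>x \<in> pverts G. traceable_from G x)
    \<or> digraph_iso G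
        (join_graph (disjoint_union (complete_graph k) (complete_graph (n - k - 1))) (complete_graph 1))
    \<or> (n = 2 * k + 1 \<and> G \<in> EW n)"
proof (cases "\<forall>x \<in> pverts G. traceable_from G x")
  case False
  then obtain x where x: "x \<in> pverts G" "\<not> traceable_from G x" by blast
  define V where "V = pverts G"
  have G: "finite V" "parcs G \<subseteq> V \<times> V" "sym (parcs G)" "irrefl (parcs G)"
    using assms(3) by (auto simp: pair_graph_iff V_def)
  have cardV: "card V = n" using assms(4) by (simp add: V_def)
  obtain E where E: "parcs G \<subseteq> E" "E \<subseteq> V \<times> V" "sym E" "irrefl E" "\<not> hamiltonian_from V E x"
    and small: "\<And>u v. u \<in> V \<Longrightarrow> v \<in> V \<Longrightarrow> u \<noteq> v \<Longrightarrow> (u, v) \<notin> E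
      \<Longrightarrow> card (E `` {u}) + card (E `` {v}) < n"
    using maximal_not_hamiltonian_from[OF G(1,2,3,4), of x] x
    unfolding traceable_from_iff[OF x(1)] V_def[symmetric] cardV by metis
  \<comment> \<open>The excess of \<open>n\<close> over \<open>2 * k + 1\<close>; the two extremal degrees are \<open>k\<close> and \<open>k + l = n - 1 - k\<close>.\<close>
  define l where "l = n - 1 - 2 * k"
  have n: "n = 2 * k + l + 1" using assms(2) by (simp add: l_def)
  define A where "A = parcs (complement_graph G)"
  define B where "B = {(u, v). u \<in> V \<and> v \<in> V \<and> u \<noteq> v \<and> (u, v) \<notin> E}"
  have A_eq: "A = {(u, v). u \<in> V \<and> v \<in> V \<and> u \<noteq> v \<and> (u, v) \<notin> parcs G}"
    by (auto simp: A_def complement_graph_def V_def)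
  have A: "A \<subseteq> V \<times> V" "sym A" and B: "B \<subseteq> A" "sym B"
    using G E by (auto simp: A_eq B_def sym_def)
  have finE: "finite (E `` {v})" for v
    using E(2) G(1) by (meson finite_Image finite_SigmaI finite_subset)
  have finB: "finite (B `` {v})" for v
    using B(1) A(1) G(1) by (meson finite_Image finite_SigmaI finite_subset)
  have degE: "k \<le> card (E `` {v})" if v: "v \<in> V" for v
  proof -
    have "k \<le> out_degree (with_proj G) v"
      using assms(5) v G(1) unfolding min_degree_def V_def[symmetric]
      by (meson Min_le finite_imageI imageI order_trans)
    also have "\<dots> \<le> card (E `` {v})"
      unfolding out_degree_pair using E(1) finE by (intro card_mono) auto
    finally show ?thesis .
  qed
  have degsum: "card (B `` {v}) + card (E `` {v}) = 2 * k + l" if v: "v \<in> V" for v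
  proof -
    have "V - {v} = B `` {v} \<union> E `` {v}" "B `` {v} \<inter> E `` {v} = {}"
      using v E by (auto simp: B_def irrefl_def)
    then have "card (V - {v}) = card (B `` {v}) + card (E `` {v})"
      using card_Un_disjoint[OF finB finE] by metis
    then show ?thesis using v G(1) cardV n by simp
  qed
  have B_edge: "k \<le> card (B `` {u}) \<and> card (B `` {u}) \<le> k + l \<and> k \<le> card (B `` {v})
    \<and> card (B `` {v}) \<le> k + l \<and> 2 * k + l \<le> card (B `` {u}) + card (B `` {v})"
    if "(u, v) \<in> B" for u v
  proof -
    have "u \<in> V" "v \<in> V" "u \<noteq> v" "(u, v) \<notin> E" using that by (auto simp: B_def)
    then show ?thesis
      using small[of u v] degsum[of u] degsum[of v] degE[of u] degE[of v] n by linarith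
  qed
  define s where "s = sqrt (real k * (real n - real k - 1))"
  have s: "s = sqrt (real (k * (k + l)))" "0 \<le> s" "s\<^sup>2 = real (k * (k + l))"
    by (simp_all add: s_def n algebra_simps)
  have form: "(\<Sum>(u, v)\<in>A. g u * g v) \<le> s * (\<Sum>v\<in>V. (g v)\<^sup>2)" for g
  proof -
    have V': "pverts (complement_graph G) = V" by (simp add: complement_graph_def V_def)
    have "(\<Sum>(u, v)\<in>A. g u * g v) \<le> graph_spectral_radius (complement_graph G) * (\<Sum>v\<in>V. (g v)\<^sup>2)"
      using arc_sum_le_spectral_radius[OF pair_graph_complement[OF assms(3)], of g] x(1)
      unfolding V' A_def by (auto simp: V_def)
    also have "\<dots> \<le> s * (\<Sum>v\<in>V. (g v)\<^sup>2)"
      using assms(6) by (intro mult_right_mono sum_nonneg) (simp_all add: s_def)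
    finally show ?thesis .
  qed
  have prod: "s\<^sup>2 \<le> real (card (B `` {u}) * card (B `` {v}))" if "(u, v) \<in> B" for u v
    unfolding s(3) using B_edge[OF that] degree_product_bound(1) of_nat_le_iff by blast
  have tight: "real (card (B `` {u}) * card (B `` {v})) = s\<^sup>2" if "(u, v) \<in> B" for u v
    using edge_degree_product_rigidity(1)[OF G(1) A B(1) s(2) form prod that] by blast
  have extra: "B `` {u} = {} \<and> B `` {v} = {}" if "(u, v) \<in> A - B" for u v
    using edge_degree_product_rigidity(2)[OF G(1) A B(1) s(2) form prod that] by blast
  have B_degs: "card (B `` {u}) = k \<and> card (B `` {v}) = k + l
    \<or> card (B `` {u}) = k + l \<and> card (B `` {v}) = k" if "(u, v) \<in> B" for u v
  proof -
    have "card (B `` {u}) * card (B `` {v}) = k * (k + l)"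
      using tight[OF that] unfolding s(3) of_nat_eq_iff .
    then show ?thesis
      using B_edge[OF that] assms(1) by (intro degree_product_bound(2)) auto
  qed
  have B_ne: "B \<noteq> {}"
  proof
    assume "B = {}"
    then have "hamiltonian_from V E x"
      using x(1) by (intro hamiltonian_from_complete G(1)) (auto simp: B_def V_def)
    with E(5) show False ..
  qed
  define W where "W = {v \<in> V. B `` {v} \<noteq> {}}"
  have WV: "W \<subseteq> V" by (auto simp: W_def)
  have finW: "finite W" using WV G(1) finite_subset by blast
  \<comment> \<open>Rigidity makes \<open>G\<close> agree with \<open>E\<close> at every pair that meets \<open>W\<close>.\<close>
  have W_arcs: "(u, v) \<in> parcs G \<longleftrightarrow> (u, v) \<notin> B" if "u \<in> W" "v \<in> V" "u \<noteq> v" for u v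
    using that extra[of u v] B(1) by (auto simp: A_eq W_def)
  have B_W: "u \<in> W \<and> v \<in> W" if "(u, v) \<in> B" for u v
  proof -
    have "(v, u) \<in> B" using that B(2) by (rule symD[rotated])
    then show ?thesis using that B(1) A(1) by (auto simp: W_def)
  qed
  show ?thesis
  proof (cases "l = 0")
    case True
    have deg_W: "card (B `` {v}) = k" if "v \<in> W" for v
      using that B_degs True by (auto simp: W_def)
    \<comment> \<open>Restricted to \<open>W\<close>, the graph \<open>G\<close> is the complement of the \<open>k\<close>-regular graph \<open>B\<close>.\<close>
    have G_W: "card (parcs G `` {v} \<inter> W) = card W - 1 - k" if v: "v \<in> W" for v
    proof -
      have "parcs G `` {v} \<inter> W = W - {v} - B `` {v}"
        using W_arcs[OF v] WV G(4) by (auto simp: irrefl_def)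
      moreover have "B `` {v} \<subseteq> W - {v}" using B_W by (auto simp: B_def)
      ultimately show ?thesis
        using v finW deg_W[OF v] finB by (simp add: card_Diff_subset)
    qed
    obtain u v where uv: "(u, v) \<in> B" using B_ne by auto
    \<comment> \<open>One vertex and its \<open>k\<close> neighbours give \<open>card W > k\<close>, which is the bound on \<open>r = n + 1 - card W\<close>.\<close>
    have "insert u (B `` {u}) \<subseteq> W" using B_W uv by auto
    then have "card (insert u (B `` {u})) \<le> card W" using finW by (rule card_mono[rotated])
    then have W_ge: "k + 1 \<le> card W"
      using finB deg_W[of u] B_W[OF uv] by (simp add: B_def)
    have W_le: "card W \<le> n" using WV G(1) cardV card_mono by blast
    have "W \<times> (V - W) \<subseteq> parcs G"
      using W_arcs WV B_W by blast
    then obtain G1 G2 :: "nat pair_pre_digraph" where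
      "regular_graph (card W - 1 - k) G1" "card (pverts G1) = card W"
      "pair_graph G2" "card (pverts G2) = card (V - W)"
      "digraph_iso (with_proj G) (with_proj (join_graph G1 G2))"
      using join_decomposition[OF assms(3) _ _ G_W] WV unfolding V_def[symmetric] by metis
    moreover have "card (V - W) = n + 1 - card W - 1"
      using WV finW cardV by (simp add: card_Diff_subset)
    moreover have "card W - 1 - k = (n + 1) div 2 - (n + 1 - card W)"
      "card W = n + 1 - (n + 1 - card W)" "1 \<le> n + 1 - card W" "n + 1 - card W \<le> (n + 1) div 2"
      "odd n"
      using W_ge W_le n True by auto
    ultimately have "G \<in> EW n"
      unfolding EW_def mem_Collect_eq using assms(3) by metis
    then show ?thesis using n True by simp
  next
    case False
    define X where "X = {v \<in> V. card (B `` {v}) = k}"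
    define Y where "Y = {v \<in> V. card (B `` {v}) = k + l}"
    have XY: "X \<subseteq> V" "Y \<subseteq> V" "Y \<inter> X = {}" using False by (auto simp: X_def Y_def)
    have fin: "finite X" "finite Y" using XY G(1) finite_subset by blast+
    have bip: "u \<in> X \<and> v \<in> Y \<or> u \<in> Y \<and> v \<in> X" if "(u, v) \<in> B" for u v
      using B_degs[OF that] that by (auto simp: X_def Y_def B_def)
    have nb: "v \<in> X \<Longrightarrow> B `` {v} \<subseteq> Y" "v \<in> Y \<Longrightarrow> B `` {v} \<subseteq> X" for v
      using bip XY(3) by blast+
    have deg: "v \<in> X \<Longrightarrow> card (B `` {v}) = k" "v \<in> Y \<Longrightarrow> card (B `` {v}) = k + l" for v
      by (auto simp: X_def Y_def)
    obtain x0 y0 where xy: "x0 \<in> X" "y0 \<in> Y" using B_ne bip by fastforce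
    \<comment> \<open>The sizes exceed these bounds by at most one in total.  If one part is as small as possible,
      then it is the neighbourhood of each vertex of the other part, so the other part is a
      neighbourhood as well and has its least size.\<close>
    have "k \<le> card Y" "k + l \<le> card X"
      using card_mono[OF fin(2) nb(1)[OF xy(1)]] card_mono[OF fin(1) nb(2)[OF xy(2)]] deg xy by auto
    moreover have sum: "card Y + card X \<le> 2 * k + l + 1"
      using card_Un_disjoint[OF fin(2,1) XY(3)] card_mono[OF G(1), of "Y \<union> X"] XY cardV n by auto
    moreover have "card Y = k" if "card X = k + l"
    proof -
      have "X = B `` {y}" if "y \<in> Y" for y
        using card_subset_eq[OF fin(1) nb(2)[OF that]] deg(2)[OF that] \<open>card X = k + l\<close> by simp
      then have "(y, x0) \<in> B" if "y \<in> Y" for y using xy(1) that by blast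
      then have "Y \<subseteq> B `` {x0}" using symD[OF B(2)] by blast
      then have "Y = B `` {x0}" using nb(1)[OF xy(1)] by auto
      then show ?thesis using deg(1)[OF xy(1)] by simp
    qed
    moreover have "card X = k + l" if "card Y = k"
    proof -
      have "Y = B `` {x}" if "x \<in> X" for x
        using card_subset_eq[OF fin(2) nb(1)[OF that]] deg(1)[OF that] \<open>card Y = k\<close> by simp
      then have "(x, y0) \<in> B" if "x \<in> X" for x using xy(2) that by blast
      then have "X \<subseteq> B `` {y0}" using symD[OF B(2)] by blast
      then have "X = B `` {y0}" using nb(2)[OF xy(2)] by auto
      then show ?thesis using deg(2)[OF xy(2)] by simp
    qed
    ultimately have cards: "card Y = k" "card X = k + l" by linarith+
    have B_eq: "(u, v) \<in> B \<longleftrightarrow> u \<in> Y \<and> v \<in> X \<or> u \<in> X \<and> v \<in> Y" for u v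
    proof -
      have "B `` {y} = X" if "y \<in> Y" for y
        using card_subset_eq[OF fin(1) nb(2)[OF that]] deg(2)[OF that] cards by simp
      moreover have "B `` {x} = Y" if "x \<in> X" for x
        using card_subset_eq[OF fin(2) nb(1)[OF that]] deg(1)[OF that] cards by simp
      ultimately show ?thesis using bip by blast
    qed
    have "card (V - (Y \<union> X)) = 1"
      using card_Un_disjoint[OF fin(2,1) XY(3)] XY fin cards cardV n
      by (subst card_Diff_subset) auto
    then obtain z where z: "V - (Y \<union> X) = {z}" by (auto simp: card_1_singleton_iff)
    have YXW: "Y \<union> X = W"
      using bip B_W B_eq xy by (auto simp: W_def X_def Y_def)
    have "digraph_iso (with_proj G) (with_proj (join_graph
      (disjoint_union (complete_graph (card Y)) (complete_graph (card X))) (complete_graph 1)))"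
    proof (rule iso_two_cliques_join_vertex[OF assms(3)])
      show "pverts G = insert z (Y \<union> X)" using z XY unfolding V_def[symmetric] by auto
      show "Y \<inter> X = {}" "z \<notin> Y" "z \<notin> X" using XY z by auto
      fix u v assume uv: "u \<in> pverts G" "v \<in> pverts G"
      show "(u, v) \<in> parcs G \<longleftrightarrow> u \<noteq> v \<and> \<not> (u \<in> Y \<and> v \<in> X) \<and> \<not> (u \<in> X \<and> v \<in> Y)"
      proof (cases "u = v")
        case True
        then show ?thesis using G(4) by (auto simp: irrefl_def)
      next
        case neq: False
        have uvV: "u \<in> V" "v \<in> V" using uv by (simp_all add: V_def)
        then have "u \<in> {z}" if "u \<notin> W" using that z unfolding YXW by blast
        moreover have "v \<in> {z}" if "v \<notin> W" using that z uvV unfolding YXW by blast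
        ultimately have "u \<in> W \<or> v \<in> W" using neq by auto
        then have "(u, v) \<in> parcs G \<longleftrightarrow> (u, v) \<notin> B"
        proof
          assume "u \<in> W"
          then show ?thesis using W_arcs uvV neq by simp
        next
          assume "v \<in> W"
          then have "(v, u) \<in> parcs G \<longleftrightarrow> (v, u) \<notin> B" using W_arcs uvV neq by simp
          then show ?thesis using symD[OF G(3)] symD[OF B(2)] by metis
        qed
        then show ?thesis using neq unfolding B_eq by blast
      qed
    qed
    moreover have "n - k - 1 = k + l" using n by simp
    ultimately show ?thesis unfolding cards by simp
  qed
qed simp

end
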